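(* For each integer $n\ge 2$, let $x_0=x_0(n)$ be an integer in $[\frac{n}{2},n-1]$ that maximizes $n(S_{1,4},K_{x,n-x})$ over all integers $x\in[\frac{n}{2},n-1]$. Then $\lim_{n \rightarrow \infty} \frac{x_0(n)}{n} = \frac{2}{3}$. (In other words, as the number of vertices $n$ tends to infinity, the complete bipartite graph $K_{x,n-x}$ maximizing the number of copies of $S_{1,4}$ has two parts with approximately $\frac{2}{3}n$ and $\frac{1}{3}n$ vertices.)
   Context: Graphs are finite and simple. For graphs $H$ and $G$, $n(H,G)$ denotes the number of (not necessarily induced) subgraphs of $G$ isomorphic to $H$. The star of degree $a$ is $K_{1,a}$, whose central vertex is the vertex of the part of size $1$. The double star $S_{a,b}$ is the graph formed from disjoint stars $K_{1,a}$ and $K_{1,b}$ by joining their central vertices by an edge. $K_{p,q}$ is the complete bipartite graph with parts of sizes $p$ and $q$. *)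

theory Defs
  imports Complex_Main
begin

type_synonym 'a sgraph = "'a set \<times> 'a set set"

abbreviation gverts :: "'a sgraph \<Rightarrow> 'a set" where
  "gverts G \<equiv> fst G"

abbreviation gedges :: "'a sgraph \<Rightarrow> 'a set set" where
  "gedges G \<equiv> snd G"

definition simple_graph :: "'a sgraph \<Rightarrow> bool" where
  "simple_graph G \<longleftrightarrow> finite (gverts G) \<and> (\<forall>e\<in>gedges G. e \<subseteq> gverts G \<and> card e = 2)"

definition subgraph_of :: "'a sgraph \<Rightarrow> 'a sgraph \<Rightarrow> bool" where
  "subgraph_of S G \<longleftrightarrow> simple_graph S \<and> gverts S \<subseteq> gverts G \<and> gedges S \<subseteq> gedges G"

definition graph_iso :: "'a sgraph \<Rightarrow> 'b sgraph \<Rightarrow> bool" where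
  "graph_iso H G \<longleftrightarrow> (\<exists>f. bij_betw f (gverts H) (gverts G) \<and>
     (\<forall>u\<in>gverts H. \<forall>v\<in>gverts H. {u, v} \<in> gedges H \<longleftrightarrow> {f u, f v} \<in> gedges G))"

definition num_copies :: "'a sgraph \<Rightarrow> 'b sgraph \<Rightarrow> nat" where
  "num_copies H G = card {S. subgraph_of S G \<and> graph_iso H S}"

definition complete_bipartite :: "nat \<Rightarrow> nat \<Rightarrow> (nat + nat) sgraph" where
  "complete_bipartite p q =
     ({..<p} <+> {..<q}, {{Inl i, Inr j} | i j. i < p \<and> j < q})"

definition star :: "nat \<Rightarrow> (nat + nat) sgraph" where
  "star a = complete_bipartite 1 a"

definition star_centre :: "nat + nat" where
  "star_centre = Inl 0"

definition disjoint_union :: "'a sgraph \<Rightarrow> 'b sgraph \<Rightarrow> ('a + 'b) sgraph" where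
  "disjoint_union G H =
     (gverts G <+> gverts H, (`) Inl ` gedges G \<union> (`) Inr ` gedges H)"

definition add_edge :: "'a \<Rightarrow> 'a \<Rightarrow> 'a sgraph \<Rightarrow> 'a sgraph" where
  "add_edge u v G = (gverts G, insert {u, v} (gedges G))"

definition double_star :: "nat \<Rightarrow> nat \<Rightarrow> ((nat + nat) + (nat + nat)) sgraph" where
  "double_star a b =
     add_edge (Inl star_centre) (Inr star_centre) (disjoint_union (star a) (star b))"

lemma simple_graph_complete_bipartite: "simple_graph (complete_bipartite p q)"
  by (auto simp: simple_graph_def complete_bipartite_def)

lemma simple_graph_disjoint_union:
  assumes "simple_graph G" "simple_graph H"
  shows "simple_graph (disjoint_union G H)"
  using assms by (fastforce simp: simple_graph_def disjoint_union_def card_image)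

lemma simple_graph_double_star: "simple_graph (double_star a b)"
proof -
  have "simple_graph (disjoint_union (star a) (star b))"
    by (simp add: star_def simple_graph_complete_bipartite simple_graph_disjoint_union)
  then show ?thesis
    by (auto simp: simple_graph_def double_star_def add_edge_def star_centre_def
        disjoint_union_def star_def complete_bipartite_def)
qed

end

theory Submission
  imports Defs
begin

text \<open>
  A copy of \<open>S\<^bsub>a,b\<^esub>\<close> with \<open>a \<noteq> b\<close> and \<open>a, b > 0\<close> is determined by its two centres and their two
  leaf sets, and the degrees \<open>a + 1\<close>, \<open>b + 1\<close> and \<open>1\<close> allow one to read all four off the copy. In a
  complete bipartite graph the centres lie in different parts and each leaf set lies in the part
  opposite to its centre, so counting the choices gives a closed formula
  (\<open>num_copies_double_star_complete_bipartite\<close>).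

  For \<open>S\<^bsub>1,4\<^esub>\<close> in \<open>K\<^bsub>p,q\<^esub>\<close> with \<open>p + q = n\<close>, 24 times this number is
  \<open>p q (p-1) (q-1) ((p-2)(p-3)(p-4) + (q-2)(q-3)(q-4))\<close>. It is symmetric in \<open>p\<close> and \<open>q\<close>, hence a
  polynomial in \<open>n\<close> and \<open>p q\<close>; with \<open>s = p q / n\<^sup>2\<close> it equals \<open>n\<^sup>7 (s\<^sup>2 (1 - 3 s) + O(1/n))\<close> uniformly
  in \<open>0 \<le> s \<le> 1/4\<close> (\<open>num_copies_eq_density\<close>, \<open>density_le\<close>). The leading term is largest exactly at
  \<open>s = 2/9 = 2/3 \<cdot> 1/3\<close>, and it falls short of its maximum quadratically in \<open>s - 2/9\<close>
  (\<open>limit_density_max\<close>). A maximizer must do at least as well as the part size nearest to \<open>2 n / 3\<close>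
  from above, so its own \<open>s\<close> is forced to tend to \<open>2/9\<close>. On \<open>y \<ge> 1/2\<close> the equation
  \<open>y (1 - y) = s\<close> is solved by \<open>y = 1/2 + \<surd>(1/4 - s)\<close>, which is continuous and equals \<open>2/3\<close> at
  \<open>s = 2/9\<close>.
\<close>

section \<open>Double stars on arbitrary vertices\<close>

definition dstar_on :: "'a \<Rightarrow> 'a \<Rightarrow> 'a set \<Rightarrow> 'a set \<Rightarrow> 'a sgraph" where
  "dstar_on u v A B = ({u, v} \<union> A \<union> B, insert {u, v} ((\<lambda>x. {u, x}) ` A \<union> (\<lambda>x. {v, x}) ` B))"

text \<open>
  The nondegeneracy conditions under which \<open>dstar_on\<close> really produces a copy of \<open>S\<^bsub>a,b\<^esub>\<close>.
\<close>
definition dstar_parts :: "nat \<Rightarrow> nat \<Rightarrow> 'a \<Rightarrow> 'a \<Rightarrow> 'a set \<Rightarrow> 'a set \<Rightarrow> bool" where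
  "dstar_parts a b u v A B \<longleftrightarrow> u \<noteq> v \<and> u \<notin> A \<union> B \<and> v \<notin> A \<union> B \<and> A \<inter> B = {} \<and>
     finite A \<and> finite B \<and> card A = a \<and> card B = b"

text \<open>
  Isomorphisms are defined by comparing adjacency on vertex pairs; since every edge is such a pair,
  the target is just the image of the source. In this form isomorphic copies compose well with the
  explicit description of double stars.
\<close>
lemma graph_iso_iff_image:
  assumes H: "simple_graph H" and S: "simple_graph S"
  shows "graph_iso H S \<longleftrightarrow>
    (\<exists>f. inj_on f (gverts H) \<and> S = (f ` gverts H, (`) f ` gedges H))"
proof
  assume "graph_iso H S"
  then obtain f where f: "bij_betw f (gverts H) (gverts S)"
    and e: "\<And>u v. u \<in> gverts H \<Longrightarrow> v \<in> gverts H \<Longrightarrow> {u, v} \<in> gedges H \<longleftrightarrow> {f u, f v} \<in> gedges S"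
    unfolding graph_iso_def by blast
  have V: "gverts S = f ` gverts H" using f by (simp add: bij_betw_def)
  have "gedges S = (`) f ` gedges H"
  proof (rule set_eqI, rule iffI)
    fix d assume d: "d \<in> gedges S"
    then have "card d = 2" "d \<subseteq> f ` gverts H" using S V by (auto simp: simple_graph_def)
    then obtain x y where xy: "x \<in> gverts H" "y \<in> gverts H" "d = {f x, f y}"
      by (auto simp: card_2_iff)
    then have "{x, y} \<in> gedges H" using d e by blast
    then show "d \<in> (`) f ` gedges H" using xy(3) by (intro image_eqI[of _ _ "{x, y}"]) auto
  next
    fix d assume "d \<in> (`) f ` gedges H"
    then obtain c where c: "c \<in> gedges H" "d = f ` c" by blast
    then have "card c = 2" "c \<subseteq> gverts H" using H by (auto simp: simple_graph_def)
    then obtain x y where "x \<in> gverts H" "y \<in> gverts H" "c = {x, y}"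
      by (auto simp: card_2_iff)
    then show "d \<in> gedges S" using c e by auto
  qed
  then have "S = (f ` gverts H, (`) f ` gedges H)" using V by (simp add: prod_eq_iff)
  then show "\<exists>f. inj_on f (gverts H) \<and> S = (f ` gverts H, (`) f ` gedges H)"
    using f by (auto simp: bij_betw_def)
next
  assume "\<exists>f. inj_on f (gverts H) \<and> S = (f ` gverts H, (`) f ` gedges H)"
  then obtain f where f: "inj_on f (gverts H)" and S': "S = (f ` gverts H, (`) f ` gedges H)"
    by blast
  have "{u, v} \<in> gedges H \<longleftrightarrow> {f u, f v} \<in> (`) f ` gedges H"
    if uv: "u \<in> gverts H" "v \<in> gverts H" for u v
  proof -
    have "gedges H \<subseteq> Pow (gverts H)" using H by (auto simp: simple_graph_def)
    then have "f ` {u, v} \<in> (`) f ` gedges H \<longleftrightarrow> {u, v} \<in> gedges H"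
      using uv by (intro inj_on_image_mem_iff[OF inj_on_image_Pow[OF f]]) auto
    then show ?thesis by simp
  qed
  then show "graph_iso H S"
    unfolding graph_iso_def S' using f by (auto simp: bij_betw_def)
qed

lemma dstar_on_image:
  "(f ` gverts (dstar_on u v A B), (`) f ` gedges (dstar_on u v A B)) =
   dstar_on (f u) (f v) (f ` A) (f ` B)"
  by (simp add: dstar_on_def image_Un image_image)

lemma double_star_eq_dstar_on:
  "double_star a b = dstar_on (Inl (Inl 0)) (Inr (Inl 0)) ((Inl \<circ> Inr) ` {..<a}) ((Inr \<circ> Inr) ` {..<b})"
proof -
  have E: "{{Inl i, Inr j} |i j. i < 1 \<and> j < c} = (\<lambda>j. {Inl (0::nat), Inr j}) ` {..<c}" for c :: nat
    by auto
  have V: "{..<1} <+> {..<c} = insert (Inl (0::nat)) (Inr ` {..<c})" for c :: nat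
    by auto
  show ?thesis
    unfolding double_star_def add_edge_def disjoint_union_def star_def complete_bipartite_def
      star_centre_def dstar_on_def E V
    by (auto simp: image_image Plus_def)
qed

lemma dstar_parts_image:
  assumes "dstar_parts a b u v A B" "inj_on f ({u, v} \<union> A \<union> B)"
  shows "dstar_parts a b (f u) (f v) (f ` A) (f ` B)"
proof -
  have "inj_on f A" "inj_on f B" using assms(2) by (auto simp: inj_on_def)
  then have "card (f ` A) = a" "card (f ` B) = b"
    using assms(1) by (auto simp: card_image dstar_parts_def)
  moreover have "f ` A \<inter> f ` B = {}"
    using assms unfolding dstar_parts_def inj_on_def by blast
  moreover have "f u \<noteq> f v" "f u \<notin> f ` A \<union> f ` B" "f v \<notin> f ` A \<union> f ` B"
    using assms unfolding dstar_parts_def inj_on_def by blast+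
  ultimately show ?thesis using assms(1) by (simp add: dstar_parts_def)
qed

lemma dstar_parts_double_star:
  "dstar_parts a b (Inl (Inl 0)) (Inr (Inl 0)) ((Inl \<circ> Inr) ` {..<a}) ((Inr \<circ> Inr) ` {..<b})"
  by (auto simp: dstar_parts_def card_image inj_on_def)

lemma simple_graph_dstar_on:
  assumes "dstar_parts a b u v A B"
  shows "simple_graph (dstar_on u v A B)"
  using assms by (auto simp: dstar_parts_def simple_graph_def dstar_on_def card_2_iff)

text \<open>
  Two double stars of the same type are related by a relabelling: bijections between the respective
  leaf sets are glued together and the centres are sent to the centres.
\<close>
lemma dstar_parts_map:
  assumes "dstar_parts a b u v A B" "dstar_parts a b u' v' A' B'"
  obtains f where "inj_on f ({u, v} \<union> A \<union> B)" "f u = u'" "f v = v'" "f ` A = A'" "f ` B = B'"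
proof -
  obtain g h where g: "bij_betw g A A'" and h: "bij_betw h B B'"
    using assms finite_same_card_bij unfolding dstar_parts_def by metis
  define f where "f x = (if x = u then u' else if x = v then v' else if x \<in> A then g x else h x)" for x
  have fA: "f x = g x" if "x \<in> A" for x using that assms(1) by (auto simp: f_def dstar_parts_def)
  have fB: "f x = h x" if "x \<in> B" for x using that assms(1) by (auto simp: f_def dstar_parts_def)
  have uv: "f u = u'" "f v = v'" using assms(1) by (auto simp: f_def dstar_parts_def)
  have bA: "bij_betw f A A'" using g bij_betw_cong[of A f g] fA by blast
  have bB: "bij_betw f B B'" using h bij_betw_cong[of B f h] fB by blast
  have "bij_betw f {u, v} {u', v'}"
    using assms uv by (auto simp: bij_betw_def inj_on_def dstar_parts_def)
  then have "bij_betw f ({u, v} \<union> A) ({u', v'} \<union> A')"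
    using assms by (intro bij_betw_combine[OF _ bA]) (auto simp: dstar_parts_def)
  then have "bij_betw f ({u, v} \<union> A \<union> B) ({u', v'} \<union> A' \<union> B')"
    using assms by (intro bij_betw_combine[OF _ bB]) (auto simp: dstar_parts_def)
  then show ?thesis using that[of f] uv bA bB by (auto simp: bij_betw_def)
qed

text \<open>
  This replaces the existential quantifier over isomorphisms by one over centres and leaf sets, which
  can be counted.
\<close>
lemma graph_iso_double_star_iff:
  assumes "simple_graph S"
  shows "graph_iso (double_star a b) S \<longleftrightarrow>
    (\<exists>u v A B. dstar_parts a b u v A B \<and> S = dstar_on u v A B)"
proof
  assume "graph_iso (double_star a b) S"
  then obtain f where f: "inj_on f (gverts (double_star a b))"
    and S: "S = (f ` gverts (double_star a b), (`) f ` gedges (double_star a b))"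
    using graph_iso_iff_image[OF simple_graph_double_star assms] by blast
  show "\<exists>u v A B. dstar_parts a b u v A B \<and> S = dstar_on u v A B"
    using dstar_parts_image[OF dstar_parts_double_star, of f a b] f S
    unfolding double_star_eq_dstar_on dstar_on_image
    by (auto simp: dstar_on_def)
next
  assume "\<exists>u v A B. dstar_parts a b u v A B \<and> S = dstar_on u v A B"
  then obtain u v A B where p: "dstar_parts a b u v A B" and S: "S = dstar_on u v A B" by blast
  have "\<exists>f. inj_on f (gverts (double_star a b)) \<and>
      (f ` gverts (double_star a b), (`) f ` gedges (double_star a b)) = S"
    unfolding S double_star_eq_dstar_on dstar_on_image
    by (rule dstar_parts_map[OF dstar_parts_double_star p]) (auto simp: dstar_on_def)
  then show "graph_iso (double_star a b) S"
    using graph_iso_iff_image[OF simple_graph_double_star assms] by metis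
qed

section \<open>Recovering centres and leaves from a double star\<close>

definition nbrs :: "'a sgraph \<Rightarrow> 'a \<Rightarrow> 'a set" where
  "nbrs G x = {y. {x, y} \<in> gedges G}"

lemma nbrs_dstar_on:
  assumes "dstar_parts a b u v A B"
  shows "nbrs (dstar_on u v A B) u = insert v A" "nbrs (dstar_on u v A B) v = insert u B"
    and "x \<notin> {u, v} \<Longrightarrow> nbrs (dstar_on u v A B) x \<subseteq> (if x \<in> A then {u} else {v})"
  using assms by (auto simp: nbrs_def dstar_on_def dstar_parts_def doubleton_eq_iff)

lemma card_nbrs_dstar_on:
  assumes "dstar_parts a b u v A B"
  shows "card (nbrs (dstar_on u v A B) u) = Suc a" "card (nbrs (dstar_on u v A B) v) = Suc b"
    and "x \<notin> {u, v} \<Longrightarrow> card (nbrs (dstar_on u v A B) x) \<le> 1"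
proof -
  show "card (nbrs (dstar_on u v A B) u) = Suc a" "card (nbrs (dstar_on u v A B) v) = Suc b"
    using assms by (auto simp: nbrs_dstar_on[OF assms] dstar_parts_def)
  show "card (nbrs (dstar_on u v A B) x) \<le> 1" if "x \<notin> {u, v}"
    by (rule order_trans[OF card_mono[OF _ nbrs_dstar_on(3)[OF assms that]]]) auto
qed

text \<open>
  The centre \<open>u\<close> is the only vertex of degree \<open>a + 1\<close>: the other centre has degree \<open>b + 1 \<noteq> a + 1\<close>, and
  leaves have degree at most \<open>1 < a + 1\<close>. The same holds for \<open>v\<close> and \<open>b + 1\<close>. The leaf sets are then
  the neighbourhoods of the centres without the opposite centre. If \<open>a = b\<close>, swapping the centres
  would give a second description of the same graph.
\<close>
lemma dstar_on_inject:
  assumes p: "dstar_parts a b u v A B" and p': "dstar_parts a b u' v' A' B'"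
    and ab: "a \<noteq> b" "a > 0" "b > 0"
    and eq: "dstar_on u v A B = dstar_on u' v' A' B'"
  shows "u = u' \<and> v = v' \<and> A = A' \<and> B = B'"
proof -
  note c = card_nbrs_dstar_on[OF p] and c' = card_nbrs_dstar_on[OF p', folded eq]
  have u: "u = u'"
    using c(3)[of u'] c'(1) c(2) ab by fastforce
  have v: "v = v'"
    using c(3)[of v'] c'(2) c(1) ab by fastforce
  have "insert v A = insert v' A'" "insert u B = insert u' B'"
    using nbrs_dstar_on(1,2)[OF p] nbrs_dstar_on(1,2)[OF p', folded eq] u v by auto
  then show ?thesis
    using u v p p' unfolding dstar_parts_def by (metis Un_iff insert_ident)
qed

section \<open>Counting double stars in complete bipartite graphs\<close>

text \<open>
  The copies whose \<open>a\<close>-centre lies in \<open>X\<close>; swapping \<open>X\<close> and \<open>Y\<close> gives the remaining ones.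
\<close>
definition bip_dstars :: "nat \<Rightarrow> nat \<Rightarrow> 'a set \<Rightarrow> 'a set \<Rightarrow> ('a \<times> 'a \<times> 'a set \<times> 'a set) set" where
  "bip_dstars a b X Y =
     (SIGMA u:X. SIGMA v:Y. {A. A \<subseteq> Y - {v} \<and> card A = a} \<times> {B. B \<subseteq> X - {u} \<and> card B = b})"

lemma card_bip_dstars:
  assumes "finite X" "finite Y"
  shows "card (bip_dstars a b X Y) =
    card X * card Y * ((card Y - 1) choose a) * ((card X - 1) choose b)"
proof -
  have sub: "finite {A. A \<subseteq> Z \<and> card A = k}" if "finite Z" for Z :: "'a set" and k
    using that by (rule rev_finite_subset[OF finite_Pow_iff[THEN iffD2]]) auto
  have "card ({A. A \<subseteq> Y - {v} \<and> card A = a} \<times> {B. B \<subseteq> X - {u} \<and> card B = b}) =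
      ((card Y - 1) choose a) * ((card X - 1) choose b)" if "u \<in> X" "v \<in> Y" for u v
    using that assms by (simp add: card_cartesian_product n_subsets)
  then have "card (SIGMA v:Y. {A. A \<subseteq> Y - {v} \<and> card A = a} \<times> {B. B \<subseteq> X - {u} \<and> card B = b}) =
      card Y * (((card Y - 1) choose a) * ((card X - 1) choose b))" if "u \<in> X" for u
    using that assms sub by (subst card_SigmaI) auto
  then show ?thesis
    unfolding bip_dstars_def using assms sub by (subst card_SigmaI) (auto intro!: finite_SigmaI)
qed

lemma subgraph_bipartite_dstar_on_iff:
  assumes p: "dstar_parts a b u v A B" and XY: "X \<inter> Y = {}"
    and G: "G = (X \<union> Y, {{x, y} |x y. x \<in> X \<and> y \<in> Y})"
  shows "subgraph_of (dstar_on u v A B) G \<longleftrightarrow>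
    (u, v, A, B) \<in> bip_dstars a b X Y \<union> bip_dstars a b Y X"
proof -
  have E: "{s, t} \<in> gedges G \<longleftrightarrow> s \<in> X \<and> t \<in> Y \<or> s \<in> Y \<and> t \<in> X" for s t
    unfolding G by (auto simp: doubleton_eq_iff)
  have V: "gverts G = X \<union> Y" by (simp add: G)
  have "subgraph_of (dstar_on u v A B) G \<longleftrightarrow>
      {u, v} \<in> gedges G \<and> (\<forall>x\<in>A. {u, x} \<in> gedges G) \<and> (\<forall>x\<in>B. {v, x} \<in> gedges G)"
  proof
    assume "{u, v} \<in> gedges G \<and> (\<forall>x\<in>A. {u, x} \<in> gedges G) \<and> (\<forall>x\<in>B. {v, x} \<in> gedges G)"
    moreover from this have "{u, v} \<union> A \<union> B \<subseteq> gverts G" unfolding E V by blast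
    ultimately show "subgraph_of (dstar_on u v A B) G"
      unfolding subgraph_of_def using simple_graph_dstar_on[OF p] by (auto simp: dstar_on_def)
  qed (auto simp: subgraph_of_def dstar_on_def)
  also have "\<dots> \<longleftrightarrow> (u, v, A, B) \<in> bip_dstars a b X Y \<union> bip_dstars a b Y X"
    unfolding E bip_dstars_def using p XY unfolding dstar_parts_def by auto
  finally show ?thesis .
qed

lemma dstar_parts_bip_dstars:
  assumes "(u, v, A, B) \<in> bip_dstars a b X Y" "X \<inter> Y = {}" "finite X" "finite Y"
  shows "dstar_parts a b u v A B"
  using assms finite_subset[of A Y] finite_subset[of B X]
  unfolding bip_dstars_def dstar_parts_def by auto

theorem num_copies_double_star_complete_bipartite:
  assumes ab: "a \<noteq> b" "a > 0" "b > 0"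
  shows "num_copies (double_star a b) (complete_bipartite p q) =
    p * q * (((q - 1) choose a) * ((p - 1) choose b) + ((p - 1) choose a) * ((q - 1) choose b))"
proof -
  define X Y :: "(nat + nat) set" where "X = Inl ` {..<p}" and "Y = Inr ` {..<q}"
  define T where "T = bip_dstars a b X Y \<union> bip_dstars a b Y X"
  have XY: "X \<inter> Y = {}" "Y \<inter> X = {}" "finite X" "finite Y" by (auto simp: X_def Y_def)
  have cXY: "card X = p" "card Y = q" by (simp_all add: X_def Y_def card_image)
  have G: "complete_bipartite p q = (X \<union> Y, {{x, y} |x y. x \<in> X \<and> y \<in> Y})"
    by (auto simp: complete_bipartite_def X_def Y_def Plus_def)
  have T: "dstar_parts a b u v A B" if "(u, v, A, B) \<in> T" for u v A B
    using that dstar_parts_bip_dstars[OF _ XY(1,3,4)] dstar_parts_bip_dstars[OF _ XY(2,4,3)]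
    unfolding T_def by blast
  have sub: "subgraph_of (dstar_on u v A B) (complete_bipartite p q) \<longleftrightarrow> (u, v, A, B) \<in> T"
    if "dstar_parts a b u v A B" for u v A B
    using subgraph_bipartite_dstar_on_iff[OF that XY(1) G] unfolding T_def .
  have "{S. subgraph_of S (complete_bipartite p q) \<and> graph_iso (double_star a b) S} =
      (\<lambda>(u, v, A, B). dstar_on u v A B) ` T" (is "?L = ?R")
  proof (rule set_eqI)
    fix S
    have "S \<in> ?L \<longleftrightarrow> subgraph_of S (complete_bipartite p q) \<and>
        (\<exists>u v A B. dstar_parts a b u v A B \<and> S = dstar_on u v A B)"
      using graph_iso_double_star_iff[of S a b] by (auto simp: subgraph_of_def)
    also have "\<dots> \<longleftrightarrow> (\<exists>u v A B. (u, v, A, B) \<in> T \<and> S = dstar_on u v A B)"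
      using sub T by blast
    finally show "S \<in> ?L \<longleftrightarrow> S \<in> ?R"
      by (simp add: image_iff Bex_def split_paired_Ex)
  qed
  moreover have "inj_on (\<lambda>(u, v, A, B). dstar_on u v A B) T"
  proof (rule inj_onI, clarsimp)
    fix u v A B u' v' A' B'
    assume "(u, v, A, B) \<in> T" "(u', v', A', B') \<in> T" "dstar_on u v A B = dstar_on u' v' A' B'"
    then show "u = u' \<and> v = v' \<and> A = A' \<and> B = B'"
      using dstar_on_inject[OF T T ab] by blast
  qed
  ultimately have "num_copies (double_star a b) (complete_bipartite p q) = card T"
    by (simp add: num_copies_def card_image)
  also have "\<dots> = card (bip_dstars a b X Y) + card (bip_dstars a b Y X)"
    unfolding T_def
  proof (rule card_Un_disjoint)
    show "bip_dstars a b X Y \<inter> bip_dstars a b Y X = {}"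
      using XY unfolding bip_dstars_def by auto
    have "bip_dstars a b X Y \<subseteq> X \<times> Y \<times> Pow Y \<times> Pow X"
      "bip_dstars a b Y X \<subseteq> Y \<times> X \<times> Pow X \<times> Pow Y"
      unfolding bip_dstars_def by auto
    then show "finite (bip_dstars a b X Y)" "finite (bip_dstars a b Y X)"
      using XY by (auto intro: finite_subset)
  qed
  also have "\<dots> = p * q * (((q - 1) choose a) * ((p - 1) choose b) + ((p - 1) choose a) * ((q - 1) choose b))"
    using XY by (simp add: card_bip_dstars cXY algebra_simps)
  finally show ?thesis .
qed

section \<open>The scaled count for the double star with 1 and 4 leaves\<close>

text \<open>
  The falling factorial also vanishes for \<open>m < 4\<close>, so the count becomes a polynomial identity with no
  case distinction for small parts.
\<close>
lemma choose_4_falling: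
  "24 * real (m choose 4) = real m * (real m - 1) * (real m - 2) * (real m - 3)"
proof -
  have "real (m choose 4) = (\<Prod>i<4. real m - real i) / fact 4"
    by (simp add: binomial_gbinomial gbinomial_prod_rev atLeast0LessThan)
  then show ?thesis
    by (simp add: fact_numeral eval_nat_numeral)
qed

text \<open>
  Here \<open>e\<close> stands for \<open>1/n\<close> and \<open>s\<close> for \<open>p q / n\<^sup>2\<close>. The factors are those of \<open>p q\<close>,
  \<open>(p-1)(q-1)\<close> and \<open>(p-2)(p-3)(p-4) + (q-2)(q-3)(q-4)\<close> after division by \<open>n\<^sup>2\<close>, \<open>n\<^sup>2\<close> and \<open>n\<^sup>3\<close>,
  rewritten with \<open>p + q = n\<close>.
\<close>
definition density :: "real \<Rightarrow> real \<Rightarrow> real" where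
  "density e s = s * (s - e + e^2) * (1 - 3*s - e * (9 - 18*s - 26*e + 48*e^2))"

lemma num_copies_eq_density:
  assumes n: "n > 0" and x: "x \<le> n"
  shows "24 * real (num_copies (double_star 1 4) (complete_bipartite x (n - x))) =
    real n ^ 7 * density (1 / real n) (real x / real n * (1 - real x / real n))"
proof (cases "x = 0 \<or> x = n")
  case True
  then show ?thesis using n by (auto simp: num_copies_double_star_complete_bipartite density_def)
next
  case False
  define p q where "p = real x" and "q = real (n - x)"
  have q: "real n = p + q" using x by (simp add: p_def q_def)
  have pq: "p + q \<noteq> 0" using n q by simp
  have pr: "real (x - 1) = p - 1" "real (n - x - 1) = q - 1"
    using False x by (auto simp: p_def q_def)
  have "24 * real (num_copies (double_star 1 4) (complete_bipartite x (n - x))) =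
     p * q * ((q - 1) * (24 * real ((x - 1) choose 4)) + (p - 1) * (24 * real ((n - x - 1) choose 4)))"
  proof -
    have count: "num_copies (double_star 1 4) (complete_bipartite x (n - x)) =
        x * (n - x) * ((n - x - 1) * ((x - 1) choose 4) + (x - 1) * ((n - x - 1) choose 4))"
      by (subst num_copies_double_star_complete_bipartite) simp_all
    show ?thesis
      unfolding count of_nat_mult of_nat_add pr p_def[symmetric] q_def[symmetric] by algebra
  qed
  also have "\<dots> = p * q * ((p - 1) * (q - 1)) * ((p - 2) * (p - 3) * (p - 4) + (q - 2) * (q - 3) * (q - 4))"
    unfolding choose_4_falling pr by (simp add: algebra_simps)
  also have "\<dots> = (p + q) ^ 7 * density (1 / (p + q)) (p / (p + q) * (1 - p / (p + q)))"
  proof -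
    \<comment> \<open>Writing \<open>p = m a\<close>, \<open>q = m (1 - a)\<close> and \<open>m e = 1\<close> removes all divisions.\<close>
    define m e a where "m = p + q" and "e = 1 / m" and "a = p / m"
    have me: "m * e = 1" and pa: "p = m * a" and qa: "q = m * (1 - a)"
      using pq by (auto simp: m_def e_def a_def field_simps)
    have "p * q = m^2 * (a * (1 - a))"
      unfolding pa qa by algebra
    moreover have "(p - 1) * (q - 1) = m^2 * (a * (1 - a) - e + e^2)"
      using me unfolding pa qa by algebra
    moreover have "(p - 2) * (p - 3) * (p - 4) + (q - 2) * (q - 3) * (q - 4) =
        m^3 * (1 - 3 * (a * (1 - a)) - e * (9 - 18 * (a * (1 - a)) - 26 * e + 48 * e^2))"
      using me unfolding pa qa by algebra
    ultimately show ?thesis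
      unfolding density_def m_def[symmetric] e_def[symmetric] a_def[symmetric]
      by (simp add: power_numeral_reduce)
  qed
  finally show ?thesis unfolding q p_def .
qed

text \<open>
  The error term is a multiple of \<open>e\<close> whose cofactor is bounded on the relevant rectangle; the constant
  100 is generous.
\<close>
lemma density_le:
  assumes "0 \<le> s" "s \<le> 1/4" "0 \<le> e" "e \<le> 1"
  shows "density e s \<le> s^2 * (1 - 3*s) + 100 * e"
proof -
  define r where "r = 9 - 18*s - 26*e + 48*e^2"
  have e2: "0 \<le> e^2" "e^2 \<le> 1" "0 \<le> e * (1 - e)" "e * (1 - e) \<le> 1"
    using assms by (simp_all add: power_le_one mult_le_one)
  have r: "-22 \<le> r" "r \<le> 57" using assms e2 unfolding r_def by linarith+
  have "s * r \<ge> s * (-22)" using r assms by (intro mult_left_mono) auto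
  moreover have "(1 - e) * (1 - 3*s) \<ge> 0" using assms by simp
  moreover have "e * (1 - e) * r \<le> e * (1 - e) * 57" using r e2 by (intro mult_left_mono) auto
  ultimately have b: "s * r + (1 - e) * (1 - 3*s) - e * (1 - e) * r \<ge> - 100"
    using assms e2 by linarith
  have "s * e * (s * r + (1 - e) * (1 - 3*s) - e * (1 - e) * r) \<ge> s * e * (- 100)"
    using assms b by (intro mult_left_mono) auto
  moreover have "s * e \<le> 1 * e" using assms by (intro mult_right_mono) auto
  moreover have "s^2 * (1 - 3*s) - density e s = s * e * (s * r + (1 - e) * (1 - 3*s) - e * (1 - e) * r)"
    unfolding density_def r_def[symmetric] by algebra
  ultimately show ?thesis by linarith
qed

text \<open>
  For \<open>s \<ge> 0\<close> this identity shows at once that \<open>4/243\<close> is the maximum of \<open>s\<^sup>2 (1 - 3 s)\<close> and that values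
  near the maximum occur only near \<open>s = 2/9\<close>. The double root at \<open>2/9\<close> comes from the critical point,
  and the third root \<open>-1/9\<close> is forced by the vanishing linear coefficient.
\<close>
lemma limit_density_max: "4/243 - s^2 * (1 - 3*s) = 3 * (s - 2/9)^2 * (s + (1/9::real))"
  by (simp add: field_simps power2_eq_square)

section \<open>Convergence of the maximizers\<close>

theorem theorem5:
  fixes x0 :: "nat \<Rightarrow> nat"
  assumes "\<And>n. n \<ge> 2 \<Longrightarrow>
    is_arg_max (\<lambda>x. num_copies (double_star 1 4) (complete_bipartite x (n - x)))
      (\<lambda>x. real n / 2 \<le> real x \<and> x \<le> n - 1) (x0 n)"
  shows "(\<lambda>n. real (x0 n) / real n) \<longlonglongrightarrow> 2 / 3"
proof -
  define y where "y n = real (x0 n) / real n" for n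
  define s where "s n = y n * (1 - y n)" for n
  \<comment> \<open>An integer part size with ratio tending to \<open>2/3\<close>, against which the maximizer is compared.
      It is admissible once \<open>n \<ge> 6\<close>, since then \<open>2 n / 3 + 1 \<le> n - 1\<close>.\<close>
  define c where "c n = nat \<lceil>2 * real n / 3\<rceil>" for n
  define z where "z n = real (c n) / real n" for n
  have lim_e: "(\<lambda>n. 1 / real n) \<longlonglongrightarrow> 0" by (rule lim_1_over_n)
  have c: "2 * real n / 3 \<le> real (c n)" "real (c n) \<le> 2 * real n / 3 + 1" for n
    unfolding c_def by linarith+
  have "z \<longlonglongrightarrow> 2/3"
  proof (rule tendsto_sandwich)
    show "\<forall>\<^sub>F n in sequentially. 2/3 \<le> z n"
      using eventually_gt_at_top[of 0] by eventually_elim (use c in \<open>simp add: z_def field_simps\<close>)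
    show "\<forall>\<^sub>F n in sequentially. z n \<le> 2/3 + 1 / real n"
      using eventually_gt_at_top[of 0] by eventually_elim (use c in \<open>simp add: z_def field_simps\<close>)
    show "(\<lambda>n. 2/3 + 1 / real n) \<longlonglongrightarrow> 2/3"
      using tendsto_add[OF tendsto_const lim_e, of "2/3"] by simp
  qed simp
  then have "(\<lambda>n. density (1 / real n) (z n * (1 - z n))) \<longlonglongrightarrow> density 0 (2/3 * (1 - 2/3))"
    unfolding density_def by (intro tendsto_intros lim_e)
  then have lim_c: "(\<lambda>n. density (1 / real n) (z n * (1 - z n))) \<longlonglongrightarrow> 4/243"
    by (simp add: density_def)
  have y: "1/2 \<le> y n"
    and le: "(s n - 2/9)^2 \<le> 3 * (4/243 - density (1 / real n) (z n * (1 - z n)) + 100 * (1 / real n))"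
    if n: "n \<ge> 6" for n
  proof -
    note am = assms[of n, unfolded is_arg_max_def]
    have x0: "real n / 2 \<le> real (x0 n)" "x0 n \<le> n - 1" using am n by auto
    have cn: "real n / 2 \<le> real (c n)" "c n \<le> n - 1" using c[of n] n by linarith+
    show y: "1/2 \<le> y n" using x0 n by (simp add: y_def field_simps)
    moreover have "y n \<le> 1" using x0 n by (simp add: y_def field_simps)
    ultimately have s0: "s n \<ge> 0" by (simp add: s_def)
    have "1/4 - s n = (y n - 1/2)^2" by (simp add: s_def power2_eq_square algebra_simps)
    then have s4: "s n \<le> 1/4" by (smt (verit) zero_le_power2)
    \<comment> \<open>Maximality is used here: the limit density at the maximizer is at least the density at the
        competitor, up to \<open>100 / n\<close>.\<close>
    have "num_copies (double_star 1 4) (complete_bipartite (c n) (n - c n)) \<le>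
        num_copies (double_star 1 4) (complete_bipartite (x0 n) (n - x0 n))"
      using am cn n not_less by auto
    then have "24 * real (num_copies (double_star 1 4) (complete_bipartite (c n) (n - c n))) \<le>
        24 * real (num_copies (double_star 1 4) (complete_bipartite (x0 n) (n - x0 n)))" by simp
    then have "real n ^ 7 * density (1 / real n) (z n * (1 - z n)) \<le> real n ^ 7 * density (1 / real n) (s n)"
      using n cn x0 by (subst (asm) (1 2) num_copies_eq_density) (auto simp only: z_def s_def y_def)
    then have "density (1 / real n) (z n * (1 - z n)) \<le> density (1 / real n) (s n)"
      using n by (subst (asm) mult_le_cancel_left_pos) auto
    also have "\<dots> \<le> (s n)^2 * (1 - 3 * s n) + 100 * (1 / real n)"
      using s0 s4 n by (intro density_le) auto
    finally have "3 * (s n - 2/9)^2 * (s n + 1/9) \<le>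
        4/243 - density (1 / real n) (z n * (1 - z n)) + 100 * (1 / real n)"
      unfolding limit_density_max[symmetric] by simp
    moreover have "3 * (s n - 2/9)^2 * (1/9) \<le> 3 * (s n - 2/9)^2 * (s n + 1/9)"
      using s0 by (intro mult_left_mono) auto
    ultimately show "(s n - 2/9)^2 \<le> 3 * (4/243 - density (1 / real n) (z n * (1 - z n)) + 100 * (1 / real n))"
      by simp
  qed
  have "(\<lambda>n. (s n - 2/9)^2) \<longlonglongrightarrow> 0"
  proof (rule tendsto_sandwich[OF _ _ tendsto_const])
    show "(\<lambda>n. 3 * (4/243 - density (1 / real n) (z n * (1 - z n)) + 100 * (1 / real n))) \<longlonglongrightarrow> 0"
      using tendsto_mult[OF tendsto_const tendsto_add[OF tendsto_diff[OF tendsto_const lim_c]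
          tendsto_mult[OF tendsto_const lim_e]], of 3 "4/243" 100] by simp
    show "\<forall>\<^sub>F n in sequentially. (s n - 2/9)^2 \<le>
        3 * (4/243 - density (1 / real n) (z n * (1 - z n)) + 100 * (1 / real n))"
      using eventually_ge_at_top[of 6] by eventually_elim (rule le)
  qed simp
  from tendsto_real_sqrt[OF this] have "s \<longlonglongrightarrow> 2/9"
    by (simp add: tendsto_rabs_zero_iff LIM_zero_iff)
  then have "(\<lambda>n. 1/2 + sqrt (1/4 - s n)) \<longlonglongrightarrow> 1/2 + sqrt (1/4 - 2/9)"
    by (intro tendsto_intros)
  moreover have "sqrt (1/4 - 2/9) = 1/6"
    by (rule real_sqrt_unique) (auto simp: power2_eq_square)
  moreover have "\<forall>\<^sub>F n in sequentially. 1/2 + sqrt (1/4 - s n) = y n"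
    using eventually_ge_at_top[of 6]
  proof eventually_elim
    case (elim n)
    have "1/4 - s n = (y n - 1/2)^2" by (simp add: s_def power2_eq_square algebra_simps)
    then show ?case using y[OF elim] by simp
  qed
  moreover have "1/2 + 1/6 = (2/3 :: real)" by simp
  ultimately show ?thesis
    unfolding y_def[symmetric] by (metis Lim_transform_eventually)
qed

end
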